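(* Let $\mu,\nu,c,d\in\mathbb{C}$ with $|\mu|\le 1$ and $|\nu|\le 1$, and let $\Phi_1(z)=\mu z+c$ and $\Phi_2(z)=\nu z+d$ be such that the composition operators $C_{\Phi_1}$ and $C_{\Phi_2}$ are bounded on $H_E(\zeta)$. Then $C_{\Phi_1}^*=C_{\Phi_2}$ if and only if $c=0$, $d=0$ and $\overline{\mu}=\nu$.
   Context: Let $\mathbb{N}_0=\mathbb{N}\cup\{0\}$ and let $\zeta=(\zeta_n)_{n\in\mathbb{N}_0}$ be a sequence of positive real numbers with $\lim_{n\to\infty}\zeta_n^{1/n}=\infty$. The weighted Hardy space of entire functions induced by $\zeta$ is the Hilbert space $H_E(\zeta)=\{g(z)=\sum_{n=0}^\infty b_nz^n : \|g\|^2=\sum_{n=0}^\infty |b_n|^2\zeta_n^2<\infty\}$ of entire functions on $\mathbb{C}$, with inner product $\langle g,h\rangle=\sum_{n=0}^\infty b_n\overline{c_n}\zeta_n^2$ for $g(z)=\sum b_nz^n$ and $h(z)=\sum c_nz^n$ in $H_E(\zeta)$. For an entire function $\Phi:\mathbb{C}\to\mathbb{C}$, the composition operator is $C_\Phi f=f\circ\Phi$; it is bounded on $H_E(\zeta)$ if it maps $H_E(\zeta)$ into itself as a bounded linear operator. The adjoint $C_\Phi^*$ is the Hilbert space adjoint. *)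

theory Defs
  imports "HOL-Complex_Analysis.Complex_Analysis"
begin

text \<open>
  Weight sequences inducing a space of entire functions. The value of \<open>root n (\<zeta> n)\<close> at
  \<open>n = 0\<close> is immaterial for the limit.
\<close>
definition entire_weight :: "(nat \<Rightarrow> real) \<Rightarrow> bool" where
  "entire_weight \<zeta> \<longleftrightarrow>
     (\<forall>n. 0 < \<zeta> n) \<and> filterlim (\<lambda>n. root n (\<zeta> n)) at_top sequentially"

text \<open>
  The \<open>n\<close>-th power series coefficient at the origin. For entire \<open>g\<close> the power series with these
  coefficients converges to \<open>g\<close> on the whole plane.
\<close>
definition pscoeff :: "(complex \<Rightarrow> complex) \<Rightarrow> nat \<Rightarrow> complex" where
  "pscoeff g n = fps_nth (fps_expansion g 0) n"

definition H_E :: "(nat \<Rightarrow> real) \<Rightarrow> (complex \<Rightarrow> complex) set" where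
  "H_E \<zeta> = {g. g holomorphic_on UNIV \<and> summable (\<lambda>n. (cmod (pscoeff g n))\<^sup>2 * (\<zeta> n)\<^sup>2)}"

definition HE_inner ::
    "(nat \<Rightarrow> real) \<Rightarrow> (complex \<Rightarrow> complex) \<Rightarrow> (complex \<Rightarrow> complex) \<Rightarrow> complex" where
  "HE_inner \<zeta> g h = (\<Sum>n. pscoeff g n * cnj (pscoeff h n) * of_real ((\<zeta> n)\<^sup>2))"

definition HE_norm :: "(nat \<Rightarrow> real) \<Rightarrow> (complex \<Rightarrow> complex) \<Rightarrow> real" where
  "HE_norm \<zeta> g = sqrt (\<Sum>n. (cmod (pscoeff g n))\<^sup>2 * (\<zeta> n)\<^sup>2)"

definition comp_op ::
    "(complex \<Rightarrow> complex) \<Rightarrow> (complex \<Rightarrow> complex) \<Rightarrow> (complex \<Rightarrow> complex)" where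
  "comp_op \<Phi> f = f \<circ> \<Phi>"

text \<open>Operators on \<open>H_E \<zeta>\<close> are total maps of functions whose values outside \<open>H_E \<zeta>\<close> are irrelevant.\<close>
definition HE_bounded_operator ::
    "(nat \<Rightarrow> real) \<Rightarrow> ((complex \<Rightarrow> complex) \<Rightarrow> (complex \<Rightarrow> complex)) \<Rightarrow> bool" where
  "HE_bounded_operator \<zeta> T \<longleftrightarrow>
     (\<forall>f\<in>H_E \<zeta>. T f \<in> H_E \<zeta>) \<and>
     (\<forall>f\<in>H_E \<zeta>. \<forall>g\<in>H_E \<zeta>. T (\<lambda>z. f z + g z) = (\<lambda>z. T f z + T g z)) \<and>
     (\<forall>a. \<forall>f\<in>H_E \<zeta>. T (\<lambda>z. a * f z) = (\<lambda>z. a * T f z)) \<and>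
     (\<exists>K. \<forall>f\<in>H_E \<zeta>. HE_norm \<zeta> (T f) \<le> K * HE_norm \<zeta> f)"

text \<open>
  The Hilbert space adjoint: for bounded \<open>T\<close> and \<open>g \<in> H_E \<zeta>\<close>, the unique (Riesz) element \<open>h\<close> of
  \<open>H_E \<zeta>\<close> with \<open>\<langle>T f, g\<rangle> = \<langle>f, h\<rangle>\<close> for all \<open>f \<in> H_E \<zeta>\<close>.
\<close>
definition HE_adjoint ::
    "(nat \<Rightarrow> real) \<Rightarrow> ((complex \<Rightarrow> complex) \<Rightarrow> (complex \<Rightarrow> complex)) \<Rightarrow>
     (complex \<Rightarrow> complex) \<Rightarrow> (complex \<Rightarrow> complex)" where
  "HE_adjoint \<zeta> T g =
     (THE h. h \<in> H_E \<zeta> \<and> (\<forall>f\<in>H_E \<zeta>. HE_inner \<zeta> (T f) g = HE_inner \<zeta> f h))"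

end

theory Submission
  imports Defs
begin

text \<open>
  Two values of the adjoint suffice. Since \<open>\<langle>f \<circ> \<Phi>\<^sub>1, 1\<rangle> = f(c) \<zeta>\<^sub>0\<^sup>2\<close>, the adjoint sends the constant
  \<open>1\<close> to a multiple of the reproducing kernel at \<open>c\<close>, which is known explicitly; it can only equal
  \<open>1 \<circ> \<Phi>\<^sub>2 = 1\<close> if its linear coefficient, a multiple of \<open>cnj c\<close>, vanishes. Once \<open>c = 0\<close>, composition
  with \<open>\<mu> z\<close> multiplies the \<open>n\<close>-th coefficient by \<open>\<mu> ^ n\<close>, so that its adjoint is composition with
  \<open>cnj \<mu> z\<close>; evaluating it at the identity function identifies \<open>\<nu>\<close> and \<open>d\<close>. In this way no appeal
  to the Riesz representation theorem is needed.
\<close>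

lemma pscoeff_sums:
  assumes "g holomorphic_on UNIV"
  shows "(\<lambda>n. pscoeff g n * z ^ n) sums g z"
  using holomorphic_power_series[of g 0 "norm z + 1" z] holomorphic_on_subset[OF assms]
  by (simp add: pscoeff_def fps_expansion_def)

text \<open>Convergence at every point forces infinite radius of convergence, and a function has
  only one power series at the origin. This lets functions be built from their coefficients.\<close>

lemma entire_power_series:
  assumes "\<And>z. (\<lambda>n. a n * z ^ n) sums g z"
  shows holomorphic_entire_power_series: "g holomorphic_on UNIV"
    and pscoeff_entire_power_series: "pscoeff g = a"
proof -
  have rad: "fps_conv_radius (Abs_fps a) = \<infinity>"
    unfolding fps_conv_radius_def using assms by (intro conv_radius_inftyI'') (auto simp: sums_iff)
  have g: "eval_fps (Abs_fps a) = g"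
    using assms by (auto simp: eval_fps_def sums_iff)
  show "g holomorphic_on UNIV"
    using holomorphic_on_eval_fps[of UNIV "Abs_fps a"] rad g by simp
  have "g has_fps_expansion Abs_fps a"
    using eval_fps_has_fps_expansion[of "Abs_fps a"] rad g by simp
  from fps_nth_fps_expansion[OF this] show "pscoeff g = a"
    by (auto simp: pscoeff_def fps_expansion_def)
qed

lemma entire_eqI_pscoeff:
  assumes "g holomorphic_on UNIV" "h holomorphic_on UNIV" "pscoeff g = pscoeff h"
  shows "g = h"
  using pscoeff_sums[OF assms(1)] pscoeff_sums[OF assms(2)] assms(3) sums_unique2 by fastforce

lemma pscoeff_0: "pscoeff g 0 = g 0"
  by (simp add: pscoeff_def fps_expansion_def)

lemma pscoeff_power: "pscoeff (\<lambda>z. z ^ k) = (\<lambda>n. if n = k then 1 else 0)"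
proof (rule pscoeff_entire_power_series)
  fix z :: complex
  show "(\<lambda>n. (if n = k then 1 else 0) * z ^ n) sums z ^ k"
    using sums_single[of k "\<lambda>n. z ^ n"] by (simp add: if_distrib[of "\<lambda>x. x * _"] cong: if_cong)
qed

lemma power_scaled_sums:
  assumes "g holomorphic_on UNIV"
  shows "(\<lambda>n. (m ^ n * pscoeff g n) * z ^ n) sums g (m * z)"
  using pscoeff_sums[OF assms, of "m * z"] by (simp add: power_mult_distrib mult_ac)

lemma pscoeff_scale:
  assumes "g holomorphic_on UNIV"
  shows "pscoeff (\<lambda>z. g (m * z)) = (\<lambda>n. m ^ n * pscoeff g n)"
  using power_scaled_sums[OF assms] by (rule pscoeff_entire_power_series)

lemma power_in_H_E: "(\<lambda>z. z ^ k) \<in> H_E \<zeta>"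
proof -
  have "summable (\<lambda>n. (cmod (pscoeff (\<lambda>z. z ^ k) n))\<^sup>2 * (\<zeta> n)\<^sup>2)"
    by (rule summable_finite[of "{k}"]) (auto simp: pscoeff_power)
  thus ?thesis by (auto simp: H_E_def intro!: holomorphic_intros)
qed

text \<open>The factors \<open>m ^ n\<close> have modulus at most 1, so the norm series is dominated
  termwise by that of \<open>g\<close>.\<close>

lemma scale_in_H_E:
  assumes "g \<in> H_E \<zeta>" "cmod m \<le> 1"
  shows "(\<lambda>z. g (m * z)) \<in> H_E \<zeta>"
proof -
  have g: "g holomorphic_on UNIV" and s: "summable (\<lambda>n. (cmod (pscoeff g n))\<^sup>2 * (\<zeta> n)\<^sup>2)"
    using assms by (auto simp: H_E_def)
  have "(cmod (m ^ n * pscoeff g n))\<^sup>2 * (\<zeta> n)\<^sup>2 \<le> (cmod (pscoeff g n))\<^sup>2 * (\<zeta> n)\<^sup>2" for n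
    using assms(2)
    by (intro mult_right_mono power_mono) (auto simp: norm_mult norm_power power_le_one mult_left_le_one_le)
  hence "summable (\<lambda>n. (cmod (m ^ n * pscoeff g n))\<^sup>2 * (\<zeta> n)\<^sup>2)"
    by (intro summable_comparison_test'[OF s, of 0]) auto
  thus ?thesis
    using holomorphic_entire_power_series[OF power_scaled_sums[OF g]] by (simp add: H_E_def pscoeff_scale[OF g])
qed

lemma HE_inner_power_left: "HE_inner \<zeta> (\<lambda>z. z ^ k) h = cnj (pscoeff h k) * of_real ((\<zeta> k)\<^sup>2)"
  unfolding HE_inner_def by (subst suminf_finite[of "{k}"]) (auto simp: pscoeff_power)

lemma HE_inner_1_right: "HE_inner \<zeta> g (\<lambda>_. 1) = g 0 * of_real ((\<zeta> 0)\<^sup>2)"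
  unfolding HE_inner_def using pscoeff_power[of 0]
  by (subst suminf_finite[of "{0}"]) (auto simp: pscoeff_0)

text \<open>Exhibiting \<open>h\<close> settles existence for the \<open>THE\<close> in
  \<open>HE_adjoint\<close>. For uniqueness, testing against the monomials recovers each
  coefficient, because the weights are nonzero.\<close>

lemma HE_adjoint_eqI:
  assumes \<zeta>: "\<And>n. 0 < \<zeta> n" and h: "h \<in> H_E \<zeta>"
    and adj: "\<And>f. f \<in> H_E \<zeta> \<Longrightarrow> HE_inner \<zeta> (T f) g = HE_inner \<zeta> f h"
  shows "HE_adjoint \<zeta> T g = h"
  unfolding HE_adjoint_def
proof (rule the_equality)
  fix h' assume h': "h' \<in> H_E \<zeta> \<and> (\<forall>f\<in>H_E \<zeta>. HE_inner \<zeta> (T f) g = HE_inner \<zeta> f h')"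
  have "pscoeff h' k = pscoeff h k" for k
  proof -
    have "HE_inner \<zeta> (\<lambda>z. z ^ k) h' = HE_inner \<zeta> (\<lambda>z. z ^ k) h"
      using h' adj power_in_H_E[of k \<zeta>] by metis
    thus ?thesis using \<zeta>[of k] by (simp add: HE_inner_power_left)
  qed
  thus "h' = h" using h h' by (intro entire_eqI_pscoeff) (auto simp: H_E_def)
qed (use h adj in auto)

text \<open>This growth estimate serves twice for the kernel series: with \<open>r\<close> = |w||z|
  for convergence at \<open>z\<close>, and with \<open>r\<close> = |w|^2 for finiteness of the
  norm.\<close>

lemma summable_power_over_weight:
  fixes r :: real
  assumes "entire_weight \<zeta>" "0 \<le> r"
  shows "summable (\<lambda>n. r ^ n / (\<zeta> n)\<^sup>2)"
proof -
  have pos: "\<And>n. 0 < \<zeta> n" and lim: "filterlim (\<lambda>n. root n (\<zeta> n)) at_top sequentially"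
    using assms by (auto simp: entire_weight_def)
  \<comment> \<open>The threshold \<open>r + 1\<close> is chosen because its square exceeds
    \<open>r\<close>, which makes the geometric ratio below less than 1.\<close>
  have "eventually (\<lambda>n. r + 1 \<le> root n (\<zeta> n)) sequentially"
    using lim by (auto simp: filterlim_at_top)
  hence "eventually (\<lambda>n. norm (r ^ n / (\<zeta> n)\<^sup>2) \<le> (r / (r + 1)\<^sup>2) ^ n) sequentially"
    \<comment> \<open>The identity \<open>root n (\<zeta> n) ^ n = \<zeta> n\<close> requires
      positive \<open>n\<close>, since \<open>root 0\<close> is constantly 0.\<close>
    using eventually_gt_at_top[of 0]
  proof eventually_elim
    case (elim n)
    have "(r + 1) ^ n \<le> root n (\<zeta> n) ^ n"
      using elim assms by (intro power_mono) auto
    also have "\<dots> = \<zeta> n" using elim pos[of n] by simp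
    finally have "((r + 1) ^ n)\<^sup>2 \<le> (\<zeta> n)\<^sup>2" using assms by (intro power_mono) auto
    hence "((r + 1)\<^sup>2) ^ n \<le> (\<zeta> n)\<^sup>2" by (simp add: power_mult[symmetric] mult.commute)
    thus ?case using assms pos[of n] by (auto simp: power_divide intro!: divide_left_mono)
  qed
  moreover have "summable (\<lambda>n. (r / (r + 1)\<^sup>2) ^ n)"
  proof (rule summable_geometric)
    have "r < (r + 1)\<^sup>2" using assms by (simp add: power2_eq_square algebra_simps add_pos_nonneg)
    thus "norm (r / (r + 1)\<^sup>2) < 1" using assms by (auto simp: divide_simps)
  qed
  ultimately show ?thesis by (rule summable_comparison_test_ev)
qed

text \<open>Pairing with 1 sees only the value at the origin, so \<open>\<Phi>\<close> enters only
  through w = \<open>\<Phi> 0\<close>. The sequence \<open>a\<close> lists the coefficients of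
  \<open>(\<zeta> 0)\<^sup>2\<close> times the reproducing kernel at w.\<close>

lemma HE_adjoint_comp_op_1:
  fixes \<Phi> :: "complex \<Rightarrow> complex"
  assumes \<zeta>: "entire_weight \<zeta>"
  defines "a \<equiv> \<lambda>n. cnj (\<Phi> 0) ^ n * of_real ((\<zeta> 0)\<^sup>2 / (\<zeta> n)\<^sup>2)"
  shows "pscoeff (HE_adjoint \<zeta> (comp_op \<Phi>) (\<lambda>_. 1)) = a"
proof -
  have pos: "\<And>n. 0 < \<zeta> n" using \<zeta> by (auto simp: entire_weight_def)
  have "summable (\<lambda>n. a n * z ^ n)" for z
  proof (rule summable_norm_cancel)
    have "summable (\<lambda>n. (\<zeta> 0)\<^sup>2 * ((cmod (\<Phi> 0) * cmod z) ^ n / (\<zeta> n)\<^sup>2))"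
      by (intro summable_mult summable_power_over_weight \<zeta>) auto
    thus "summable (\<lambda>n. norm (a n * z ^ n))"
      by (simp add: a_def norm_mult norm_power norm_divide power_mult_distrib mult_ac)
  qed
  hence sums: "\<And>z. (\<lambda>n. a n * z ^ n) sums (\<Sum>n. a n * z ^ n)" by (rule summable_sums)
  define h where "h = (\<lambda>z. \<Sum>n. a n * z ^ n)"
  have h: "h holomorphic_on UNIV" "pscoeff h = a"
    unfolding h_def using entire_power_series[OF sums] by auto
  have "summable (\<lambda>n. (\<zeta> 0) ^ 4 * (((cmod (\<Phi> 0))\<^sup>2) ^ n / (\<zeta> n)\<^sup>2))"
    by (intro summable_mult summable_power_over_weight \<zeta>) auto
  also have "(\<lambda>n. (\<zeta> 0) ^ 4 * (((cmod (\<Phi> 0))\<^sup>2) ^ n / (\<zeta> n)\<^sup>2)) = (\<lambda>n. (cmod (a n))\<^sup>2 * (\<zeta> n)\<^sup>2)"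
  proof
    fix n
    have "(cmod (a n))\<^sup>2 = ((cmod (\<Phi> 0))\<^sup>2) ^ n * ((\<zeta> 0) ^ 4 / (\<zeta> n) ^ 4)"
      by (simp add: a_def norm_mult norm_power norm_divide power_mult_distrib power_divide
          power_mult[symmetric] mult.commute)
    thus "(\<zeta> 0) ^ 4 * (((cmod (\<Phi> 0))\<^sup>2) ^ n / (\<zeta> n)\<^sup>2) = (cmod (a n))\<^sup>2 * (\<zeta> n)\<^sup>2"
      using pos[of n] by (simp add: field_simps power2_eq_square power4_eq_xxxx)
  qed
  finally have hH: "h \<in> H_E \<zeta>" using h by (simp add: H_E_def)
  have "HE_adjoint \<zeta> (comp_op \<Phi>) (\<lambda>_. 1) = h"
  proof (rule HE_adjoint_eqI[OF pos hH])
    fix f assume "f \<in> H_E \<zeta>"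
    hence "(\<lambda>n. pscoeff f n * \<Phi> 0 ^ n * of_real ((\<zeta> 0)\<^sup>2)) sums (f (\<Phi> 0) * of_real ((\<zeta> 0)\<^sup>2))"
      by (intro sums_mult2 pscoeff_sums) (auto simp: H_E_def)
    \<comment> \<open>In \<open>cnj (a n) * (\<zeta> n)\<^sup>2\<close> the weight of index
      \<open>n\<close> cancels and the conjugation is undone, leaving
      \<open>\<Phi> 0 ^ n * (\<zeta> 0)\<^sup>2\<close>.\<close>
    also have "(\<lambda>n. pscoeff f n * \<Phi> 0 ^ n * of_real ((\<zeta> 0)\<^sup>2))
        = (\<lambda>n. pscoeff f n * cnj (pscoeff h n) * of_real ((\<zeta> n)\<^sup>2))"
      using pos by (auto simp: h a_def less_imp_neq[THEN not_sym])
    finally show "HE_inner \<zeta> (comp_op \<Phi> f) (\<lambda>_. 1) = HE_inner \<zeta> f h"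
      by (simp add: HE_inner_1_right HE_inner_def comp_op_def sums_iff)
  qed
  thus ?thesis using h by simp
qed

text \<open>The operator is diagonal in the monomials, with entries \<open>m ^ n\<close>; moving
  such an entry to the second argument of the inner product conjugates it.\<close>

lemma HE_adjoint_comp_op_scale:
  assumes "\<And>n. 0 < \<zeta> n" "cmod m \<le> 1" "g \<in> H_E \<zeta>"
  shows "HE_adjoint \<zeta> (comp_op (\<lambda>z. m * z)) g = comp_op (\<lambda>z. cnj m * z) g"
proof (rule HE_adjoint_eqI)
  show "comp_op (\<lambda>z. cnj m * z) g \<in> H_E \<zeta>"
    using scale_in_H_E[of g \<zeta> "cnj m"] assms by (simp add: comp_op_def o_def)
  fix f assume "f \<in> H_E \<zeta>"
  hence "f holomorphic_on UNIV" "g holomorphic_on UNIV"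
    using assms(3) by (auto simp: H_E_def)
  from this[THEN pscoeff_scale]
  show "HE_inner \<zeta> (comp_op (\<lambda>z. m * z) f) g = HE_inner \<zeta> f (comp_op (\<lambda>z. cnj m * z) g)"
    by (simp add: HE_inner_def comp_op_def o_def mult_ac(1) mult.left_commute)
qed (use assms in auto)

theorem theorem2p1:
  fixes \<zeta> :: "nat \<Rightarrow> real" and \<mu> \<nu> c d :: complex
    and \<Phi>\<^sub>1 \<Phi>\<^sub>2 :: "complex \<Rightarrow> complex"
  assumes "entire_weight \<zeta>"
    and "cmod \<mu> \<le> 1" and "cmod \<nu> \<le> 1"
    and "\<Phi>\<^sub>1 = (\<lambda>z. \<mu> * z + c)" and "\<Phi>\<^sub>2 = (\<lambda>z. \<nu> * z + d)"
    and "HE_bounded_operator \<zeta> (comp_op \<Phi>\<^sub>1)"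
    and "HE_bounded_operator \<zeta> (comp_op \<Phi>\<^sub>2)"
  shows "(\<forall>g\<in>H_E \<zeta>. HE_adjoint \<zeta> (comp_op \<Phi>\<^sub>1) g = comp_op \<Phi>\<^sub>2 g)
           \<longleftrightarrow> c = 0 \<and> d = 0 \<and> cnj \<mu> = \<nu>"
proof
  have pos: "\<And>n. 0 < \<zeta> n" using assms(1) by (auto simp: entire_weight_def)
  assume adj: "\<forall>g\<in>H_E \<zeta>. HE_adjoint \<zeta> (comp_op \<Phi>\<^sub>1) g = comp_op \<Phi>\<^sub>2 g"
  have "HE_adjoint \<zeta> (comp_op \<Phi>\<^sub>1) (\<lambda>_. 1) = (\<lambda>_. 1)"
    using adj power_in_H_E[of 0 \<zeta>] by (simp add: comp_op_def o_def)
  \<comment> \<open>Index 1 is the first that carries information: at index 0 both sides equal 1 for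
    every \<open>c\<close>.\<close>
  hence "pscoeff (\<lambda>_. 1) 1 = cnj c * of_real ((\<zeta> 0)\<^sup>2 / (\<zeta> 1)\<^sup>2)"
    using HE_adjoint_comp_op_1[OF assms(1), of \<Phi>\<^sub>1] assms(4) by simp
  moreover have "pscoeff (\<lambda>_. 1) 1 = 0" using pscoeff_power[of 0] by simp
  ultimately have c: "c = 0" using pos[of 0] pos[of 1] by simp
  have id: "(\<lambda>z. z) \<in> H_E \<zeta>" using power_in_H_E[of 1 \<zeta>] by simp
  have "comp_op (\<lambda>z. cnj \<mu> * z) (\<lambda>z. z) = comp_op \<Phi>\<^sub>2 (\<lambda>z. z)"
    using adj[rule_format, OF id] HE_adjoint_comp_op_scale[of \<zeta>, OF pos assms(2) id] assms(4) c by simp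
  hence eq: "(\<lambda>z. cnj \<mu> * z) = (\<lambda>z. \<nu> * z + d)"
    using assms(5) by (simp add: comp_op_def o_def)
  from fun_cong[OF eq, of 0] have "d = 0" by simp
  with fun_cong[OF eq, of 1] c show "c = 0 \<and> d = 0 \<and> cnj \<mu> = \<nu>" by simp
next
  assume "c = 0 \<and> d = 0 \<and> cnj \<mu> = \<nu>"
  thus "\<forall>g\<in>H_E \<zeta>. HE_adjoint \<zeta> (comp_op \<Phi>\<^sub>1) g = comp_op \<Phi>\<^sub>2 g"
    using HE_adjoint_comp_op_scale[OF _ assms(2)] assms(1,4,5) by (auto simp: entire_weight_def)
qed

end
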